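(* Let $(X,\leq)$ be a poset and $C$ a closure operator on $X$. Then the lattice $F_{X/C}$ can be embedded into $F_X$ in such a way that all infima, all suprema, and the top and bottom elements are preserved under the embedding.
   Context: A closure operator on a poset $P$ is a map $C:P\to P$ with $p\leq C(p)$, $p\leq q\Rightarrow C(p)\leq C(q)$, $C(C(p))=C(p)$. $X/C$ is the set of equivalence classes of $x\sim' y\iff C(x)=C(y)$, ordered by $[x]\leq[y]$ iff $C(x)\leq C(y)$. For a poset $Y$, an up-set is a subset $U$ such that $x\in U$, $x\leq y$ imply $y\in U$; $\mathcal{F}_Y$ is the set of all up-sets of $Y$ and $F_Y=(\mathcal{F}_Y,\supseteq)$, a complete lattice whose meet is union and join is intersection. *)

theory Defs
  imports "HOL-Algebra.Complete_Lattice"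
begin

definition closure_operator :: "('a, 'b) gorder_scheme \<Rightarrow> ('a \<Rightarrow> 'a) \<Rightarrow> bool"
  where "closure_operator P C \<longleftrightarrow>
    C \<in> carrier P \<rightarrow> carrier P \<and>
    (\<forall>p\<in>carrier P. p \<sqsubseteq>\<^bsub>P\<^esub> C p) \<and>
    (\<forall>p\<in>carrier P. \<forall>q\<in>carrier P. p \<sqsubseteq>\<^bsub>P\<^esub> q \<longrightarrow> C p \<sqsubseteq>\<^bsub>P\<^esub> C q) \<and>
    (\<forall>p\<in>carrier P. C (C p) = C p)"

definition closure_rel :: "('a, 'b) gorder_scheme \<Rightarrow> ('a \<Rightarrow> 'a) \<Rightarrow> ('a \<times> 'a) set"
  where "closure_rel X C = {(x, y) \<in> carrier X \<times> carrier X. C x = C y}"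

definition closure_quotient :: "('a, 'b) gorder_scheme \<Rightarrow> ('a \<Rightarrow> 'a) \<Rightarrow> 'a set gorder"
  where "closure_quotient X C =
    \<lparr>carrier = carrier X // closure_rel X C, eq = (=),
     le = (\<lambda>A B. \<exists>x\<in>carrier X. \<exists>y\<in>carrier X.
       A = closure_rel X C `` {x} \<and> B = closure_rel X C `` {y} \<and> C x \<sqsubseteq>\<^bsub>X\<^esub> C y)\<rparr>"

definition up_set :: "('a, 'b) gorder_scheme \<Rightarrow> 'a set \<Rightarrow> bool"
  where "up_set Y U \<longleftrightarrow> U \<subseteq> carrier Y \<and>
    (\<forall>x\<in>U. \<forall>y\<in>carrier Y. x \<sqsubseteq>\<^bsub>Y\<^esub> y \<longrightarrow> y \<in> U)"

definition up_set_lattice :: "('a, 'b) gorder_scheme \<Rightarrow> 'a set gorder"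
  where "up_set_lattice Y = \<lparr>carrier = {U. up_set Y U}, eq = (=), le = (\<supseteq>)\<rparr>"

lemma equiv_closure_rel: "equiv (carrier X) (closure_rel X C)"
  by (auto simp: closure_rel_def intro!: equivI refl_onI symI transI)

lemma closure_class_eq_iff:
  assumes "x \<in> carrier X" "y \<in> carrier X"
  shows "closure_rel X C `` {x} = closure_rel X C `` {y} \<longleftrightarrow> C x = C y"
  using assms by (auto simp: closure_rel_def)

lemma closure_quotient_le_iff:
  assumes "x \<in> carrier X" "y \<in> carrier X"
  shows "closure_rel X C `` {x} \<sqsubseteq>\<^bsub>closure_quotient X C\<^esub> closure_rel X C `` {y}
    \<longleftrightarrow> C x \<sqsubseteq>\<^bsub>X\<^esub> C y"
proof -
  have "closure_rel X C `` {x} \<sqsubseteq>\<^bsub>closure_quotient X C\<^esub> closure_rel X C `` {y} \<longleftrightarrow>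
    (\<exists>x'\<in>carrier X. \<exists>y'\<in>carrier X. C x = C x' \<and> C y = C y' \<and> C x' \<sqsubseteq>\<^bsub>X\<^esub> C y')"
    using assms by (simp add: closure_quotient_def closure_class_eq_iff cong: bex_cong)
  then show ?thesis using assms by metis
qed

lemma partial_order_closure_quotient:
  assumes "partial_order X" "closure_operator X C"
  shows "partial_order (closure_quotient X C)"
proof -
  interpret X: partial_order X by fact
  let ?Q = "closure_quotient X C"
  let ?c = "\<lambda>x. closure_rel X C `` {x}"
  have C: "\<And>x. x \<in> carrier X \<Longrightarrow> C x \<in> carrier X"
    using assms(2) by (auto simp: closure_operator_def)
  have car: "\<And>A. A \<in> carrier ?Q \<Longrightarrow> \<exists>x\<in>carrier X. A = ?c x"
    by (auto simp: closure_quotient_def quotient_def)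
  have eqQ: "eq ?Q = (=)" by (simp add: closure_quotient_def)
  have r: "A \<sqsubseteq>\<^bsub>?Q\<^esub> A" if "A \<in> carrier ?Q" for A
    using car[OF that] C closure_quotient_le_iff X.le_refl by metis
  have a: "A = B" if h: "A \<sqsubseteq>\<^bsub>?Q\<^esub> B" "B \<sqsubseteq>\<^bsub>?Q\<^esub> A" "A \<in> carrier ?Q" "B \<in> carrier ?Q" for A B
  proof -
    obtain x y where xy: "x \<in> carrier X" "A = ?c x" "y \<in> carrier X" "B = ?c y"
      using car h by meson
    then have "C x \<sqsubseteq>\<^bsub>X\<^esub> C y" "C y \<sqsubseteq>\<^bsub>X\<^esub> C x"
      using h by (auto simp: closure_quotient_le_iff)
    then show ?thesis using xy C X.le_antisym closure_class_eq_iff by metis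
  qed
  have t: "A \<sqsubseteq>\<^bsub>?Q\<^esub> D" if h: "A \<sqsubseteq>\<^bsub>?Q\<^esub> B" "B \<sqsubseteq>\<^bsub>?Q\<^esub> D"
    "A \<in> carrier ?Q" "B \<in> carrier ?Q" "D \<in> carrier ?Q" for A B D
  proof -
    obtain x y z where xyz: "x \<in> carrier X" "A = ?c x" "y \<in> carrier X" "B = ?c y"
      "z \<in> carrier X" "D = ?c z"
      using car h by meson
    then have "C x \<sqsubseteq>\<^bsub>X\<^esub> C y" "C y \<sqsubseteq>\<^bsub>X\<^esub> C z"
      using h by (auto simp: closure_quotient_le_iff)
    then have "C x \<sqsubseteq>\<^bsub>X\<^esub> C z"
      by (rule X.le_trans) (use xyz C in auto)
    then show ?thesis using xyz by (simp add: closure_quotient_le_iff)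
  qed
  show ?thesis
  proof unfold_locales
    show "A \<sqsubseteq>\<^bsub>?Q\<^esub> D \<longleftrightarrow> B \<sqsubseteq>\<^bsub>?Q\<^esub> E" if "A .=\<^bsub>?Q\<^esub> B" "D .=\<^bsub>?Q\<^esub> E" for A B D E
      using that by (simp add: eqQ)
  qed (simp_all add: eqQ r a, (rule t; assumption))
qed

lemma is_glb_up_set_lattice:
  assumes "A \<subseteq> carrier (up_set_lattice Y)"
  shows "is_glb (up_set_lattice Y) (\<Union>A) A"
  using assms unfolding greatest_def Lower_def up_set_lattice_def up_set_def
  by simp blast

text \<open>The intersection with \<^term>\<open>carrier Y\<close> only matters for the empty family.\<close>
lemma is_lub_up_set_lattice:
  assumes "A \<subseteq> carrier (up_set_lattice Y)"
  shows "is_lub (up_set_lattice Y) (carrier Y \<inter> \<Inter>A) A"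
  using assms unfolding least_def Upper_def up_set_lattice_def up_set_def
  by simp blast

lemma partial_order_up_set_lattice: "partial_order (up_set_lattice Y)"
  by unfold_locales (auto simp: up_set_lattice_def)

lemma complete_lattice_up_set_lattice: "complete_lattice (up_set_lattice Y)"
proof -
  interpret partial_order "up_set_lattice Y" by (rule partial_order_up_set_lattice)
  show ?thesis
    by unfold_locales (use is_glb_up_set_lattice is_lub_up_set_lattice in blast)+
qed

end

theory Submission
  imports Defs
begin

text \<open>
  The class map from \<open>X\<close> to \<open>X/C\<close> is monotone and onto. Taking preimages under a monotone
  surjection sends up-sets to up-sets, commutes with arbitrary unions and intersections, and
  reflects inclusion because the map is onto.
\<close>

text \<open>The library picks an infimum by \<open>SOME\<close>. Antisymmetry makes greatest lower
  bounds unique, so the chosen one must be the known one; the join is handled in the same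
  way.\<close>

lemma inf_up_set_lattice:
  assumes "A \<subseteq> carrier (up_set_lattice Y)"
  shows "\<Sqinter>\<^bsub>up_set_lattice Y\<^esub> A = \<Union>A"
  unfolding Lattice.inf_def
  using is_glb_up_set_lattice[OF assms]
    partial_order.greatest_unique[OF partial_order_up_set_lattice _ is_glb_up_set_lattice[OF assms]]
  by (rule some_equality)

lemma sup_up_set_lattice:
  assumes "A \<subseteq> carrier (up_set_lattice Y)"
  shows "\<Squnion>\<^bsub>up_set_lattice Y\<^esub> A = carrier Y \<inter> \<Inter>A"
  unfolding Lattice.sup_def
  using is_lub_up_set_lattice[OF assms]
    partial_order.least_unique[OF partial_order_up_set_lattice _ is_lub_up_set_lattice[OF assms]]
  by (rule some_equality)

text \<open>Under reverse inclusion the smallest up-set is the greatest element; dually, the whole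
  carrier becomes the least.\<close>

lemma top_up_set_lattice: "\<top>\<^bsub>up_set_lattice Y\<^esub> = {}"
  unfolding Order.top_def
  by (rule some_equality) (auto simp: greatest_def up_set_lattice_def up_set_def)

lemma bottom_up_set_lattice: "\<bottom>\<^bsub>up_set_lattice Y\<^esub> = carrier Y"
  unfolding Order.bottom_def
  by (rule some_equality) (auto simp: least_def up_set_lattice_def up_set_def)

lemma up_set_vimage:
  assumes "p \<in> carrier X \<rightarrow> carrier Y"
    and "\<And>x y. x \<in> carrier X \<Longrightarrow> y \<in> carrier X \<Longrightarrow> x \<sqsubseteq>\<^bsub>X\<^esub> y \<Longrightarrow> p x \<sqsubseteq>\<^bsub>Y\<^esub> p y"
    and "up_set Y U"
  shows "up_set X (carrier X \<inter> p -` U)"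
  using assms unfolding up_set_def by fastforce

text \<open>Every point of \<open>U\<close> is the image of some point of \<open>S\<close>, so an
  inclusion of preimages can be pushed forward along \<open>p\<close>.\<close>

lemma vimage_subset_iff:
  assumes "p ` S = T" and "U \<subseteq> T"
  shows "S \<inter> p -` U \<subseteq> S \<inter> p -` V \<longleftrightarrow> U \<subseteq> V"
  using assms by blast

text \<open>Order-theoretic core, stated for an arbitrary monotone surjection \<open>p\<close>; the
  class map onto the quotient is the instance used later.\<close>

lemma up_set_lattice_embedding:
  fixes X :: "('a, 'c) gorder_scheme" and Y :: "('b, 'd) gorder_scheme"
  assumes onto: "p ` carrier X = carrier Y"
    and mono: "\<And>x y. x \<in> carrier X \<Longrightarrow> y \<in> carrier X \<Longrightarrow> x \<sqsubseteq>\<^bsub>X\<^esub> y \<Longrightarrow> p x \<sqsubseteq>\<^bsub>Y\<^esub> p y"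
  defines "f \<equiv> \<lambda>U. carrier X \<inter> p -` U"
  shows "f \<in> carrier (up_set_lattice Y) \<rightarrow> carrier (up_set_lattice X)"
    and "inj_on f (carrier (up_set_lattice Y))"
    and "order_emb (up_set_lattice Y) (up_set_lattice X) f"
    and "inf_pres (up_set_lattice Y) (up_set_lattice X) f"
    and "sup_pres (up_set_lattice Y) (up_set_lattice X) f"
    and "f \<top>\<^bsub>up_set_lattice Y\<^esub> = \<top>\<^bsub>up_set_lattice X\<^esub>"
    and "f \<bottom>\<^bsub>up_set_lattice Y\<^esub> = \<bottom>\<^bsub>up_set_lattice X\<^esub>"
proof -
  have p: "p \<in> carrier X \<rightarrow> carrier Y"
    using onto by auto
  show f: "f \<in> carrier (up_set_lattice Y) \<rightarrow> carrier (up_set_lattice X)"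
    using up_set_vimage[OF p mono] by (auto simp: f_def up_set_lattice_def)
  have sub: "f U \<subseteq> f V \<longleftrightarrow> U \<subseteq> V" if "U \<in> carrier (up_set_lattice Y)" for U V
    using that vimage_subset_iff[OF onto]
    by (simp add: f_def up_set_lattice_def up_set_def)
  show "inj_on f (carrier (up_set_lattice Y))"
    by (rule inj_onI) (metis sub subset_antisym order_refl)
  show "order_emb (up_set_lattice Y) (up_set_lattice X) f"
    unfolding order_emb_def
  proof (intro conjI ballI)
    fix U V
    assume "U \<in> carrier (up_set_lattice Y)" "V \<in> carrier (up_set_lattice Y)"
    then show "f U \<sqsubseteq>\<^bsub>up_set_lattice X\<^esub> f V \<longleftrightarrow> U \<sqsubseteq>\<^bsub>up_set_lattice Y\<^esub> V"
      \<comment> \<open>Both orders are reverse inclusion, so \<open>sub\<close> applies with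
        \<open>U\<close> and \<open>V\<close> exchanged.\<close>
      using sub by (simp add: up_set_lattice_def)
  qed (rule partial_order_up_set_lattice[THEN partial_order.axioms(1)])+
  \<comment> \<open>The formulas for meets and joins in the target hold for families of up-sets, so
    the image family must be one.\<close>
  have img: "f ` A \<subseteq> carrier (up_set_lattice X)" if "A \<subseteq> carrier (up_set_lattice Y)" for A
    using that f by blast
  show "inf_pres (up_set_lattice Y) (up_set_lattice X) f"
    unfolding inf_pres_def
    using img by (auto simp: complete_lattice_up_set_lattice inf_up_set_lattice f_def)
  show "sup_pres (up_set_lattice Y) (up_set_lattice X) f"
    unfolding sup_pres_def
    \<comment> \<open>The factor \<open>carrier Y\<close> of the join pulls back to all of
      \<open>carrier X\<close>, because \<open>p\<close> maps into \<open>carrier Y\<close>.\<close>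
    using img p by (auto simp: complete_lattice_up_set_lattice sup_up_set_lattice f_def)
  show "f \<top>\<^bsub>up_set_lattice Y\<^esub> = \<top>\<^bsub>up_set_lattice X\<^esub>"
    by (simp add: top_up_set_lattice f_def)
  show "f \<bottom>\<^bsub>up_set_lattice Y\<^esub> = \<bottom>\<^bsub>up_set_lattice X\<^esub>"
    using p by (auto simp: bottom_up_set_lattice f_def)
qed

theorem theorem6:
  fixes X :: "('a, 'b) gorder_scheme" and C :: "'a \<Rightarrow> 'a"
  assumes "partial_order X"
    and "closure_operator X C"
  shows "\<exists>f. f \<in> carrier (up_set_lattice (closure_quotient X C)) \<rightarrow> carrier (up_set_lattice X) \<and>
    inj_on f (carrier (up_set_lattice (closure_quotient X C))) \<and>
    order_emb (up_set_lattice (closure_quotient X C)) (up_set_lattice X) f \<and>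
    inf_pres (up_set_lattice (closure_quotient X C)) (up_set_lattice X) f \<and>
    sup_pres (up_set_lattice (closure_quotient X C)) (up_set_lattice X) f \<and>
    f \<top>\<^bsub>up_set_lattice (closure_quotient X C)\<^esub> = \<top>\<^bsub>up_set_lattice X\<^esub> \<and>
    f \<bottom>\<^bsub>up_set_lattice (closure_quotient X C)\<^esub> = \<bottom>\<^bsub>up_set_lattice X\<^esub>"
proof -
  let ?p = "\<lambda>x. closure_rel X C `` {x}"
  have onto: "?p ` carrier X = carrier (closure_quotient X C)"
    by (auto simp: closure_quotient_def quotient_def)
  \<comment> \<open>Comparing two classes means comparing closures of representatives, so this is
    monotonicity of \<open>C\<close>.\<close>
  have mono: "?p x \<sqsubseteq>\<^bsub>closure_quotient X C\<^esub> ?p y"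
    if "x \<in> carrier X" "y \<in> carrier X" "x \<sqsubseteq>\<^bsub>X\<^esub> y" for x y
    using that assms(2) by (simp add: closure_quotient_le_iff closure_operator_def)
  show ?thesis
    \<comment> \<open>The witness stays schematic until the first conjunct is resolved, which fixes
      it as the preimage map of \<open>?p\<close>.\<close>
    by (intro exI conjI) (rule up_set_lattice_embedding[where p = ?p, OF onto mono]; assumption)+
qed

end
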